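(* Let $u,v$ be packed words of length $n$. Then $$\mathbf{N}_u*(\sigma_1^t)_n*\mathbf{N}_v=\sum_{w\in W(u,v)}\ \prod_{i=1}^{\max(u)}\binom{t+\max(w^{(i)})-a_0(v^{(i)},w^{(i)})}{\max(w^{(i)})}\ \mathbf{N}_w,$$ where $W(u,v)$ is the set of packed words $w$ of length $n$ which are finer than $u$ and weakly finer than $v$, and $v^{(i)}$, $w^{(i)}$ are the packed words of the subwords of $v$ and $w$ formed by the letters at the positions of the letter $i$ in $u$.
   Context: $\mathbb{K}$ is a field of characteristic $0$, $t$ an indeterminate, and $\binom{t+c}{m}=\frac{(t+c)(t+c-1)\cdots(t+c-m+1)}{m!}$. A word over the positive integers is packed if its set of letters is $\{1,\dots,r\}$ for some $r$; then $r=\max(u)$. For a word $w$ over a totally ordered alphabet with distinct letters $b_1<\dots<b_r$, $\mathrm{pack}(w)$ is obtained by replacing each $b_i$ by $i$. A packed word $u=u_1\cdots u_n$ is identified with the set composition of $\{1,\dots,n\}$ whose $i$-th block is $\{j:u_j=i\}$. For packed words of length $n$: $w$ is finer than $u$, $w\ge u$, if the set composition $u$ is obtained from $w$ by merging some consecutive blocks (equivalently $w_i\le w_j\Rightarrow u_i\le u_j$ for all $i,j$); $w$ is weakly finer than $v$, $w\in\mathrm{WRef}(v)$, if $w_i=w_j\Rightarrow v_i=v_j$ for all $i,j$. For packed words $v,w$ of the same length with $w\in\mathrm{WRef}(v)$, $u_0(v,w)$ is the set composition obtained from $w$ by merging two consecutive blocks $p',p''$ whenever the blocks of $v$ containing (the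 elements of) $p'$ are strictly to the left of those containing (the elements of) $p''$ (i.e. $v_i<v_j$ for all $i\in p'$, $j\in p''$), and iterating until no further blocks can be merged; $a_0(v,w)=\max(u_0(v,w))$ is its number of blocks. $\mathbf{WQSym}^*_n$ is the $\mathbb{K}$-vector space with basis $\mathbf{N}_u$, $u$ running over packed words of length $n$, with (associative) internal product $\mathbf{N}_u*\mathbf{N}_v=\mathbf{N}_{\mathrm{pack}\binom{u}{v}}$, where $\binom{u}{v}$ is the word of biletters $\binom{u_1}{v_1}\cdots\binom{u_n}{v_n}$, ordered lexicographically with priority to the top letter; scalars are extended to $\mathbb{K}[t]$. The degree $n$ component of $\sigma_1^t$ is $(\sigma_1^t)_n=\sum_{|u|=n}\binom{t}{\max(u)}\mathbf{N}_u$, the sum being over all packed words of length $n$. *)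

theory Defs
  imports
    "HOL-Library.Poly_Mapping"
    "HOL-Library.Product_Lexorder"
    "HOL-Library.Confluence"
    "HOL-Computational_Algebra.Polynomial"
begin

section \<open>Packed words\<close>

text \<open>Words over the positive integers are lists of natural numbers. The positions of a word of
  length \<open>n\<close> are \<open>0, \<dots>, n - 1\<close> rather than \<open>1, \<dots>, n\<close>. The empty word is packed, with maximum 0.\<close>

definition packed :: "nat list \<Rightarrow> bool" where
  "packed u \<longleftrightarrow> (\<exists>r. set u = {1..r})"

definition wmax :: "nat list \<Rightarrow> nat" where
  "wmax u = Max (insert 0 (set u))"

definition packed_words :: "nat \<Rightarrow> nat list set" where
  "packed_words n = {u. packed u \<and> length u = n}"

text \<open>The \<open>i\<close>-th smallest letter \<open>b\<close> of a word is the one with exactly \<open>i\<close> letters \<open>\<le> b\<close>.\<close>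

definition pack :: "'a::linorder list \<Rightarrow> nat list" where
  "pack w = map (\<lambda>b. card {c \<in> set w. c \<le> b}) w"

definition finer :: "nat list \<Rightarrow> nat list \<Rightarrow> bool" where
  "finer w u \<longleftrightarrow> length w = length u \<and>
     (\<forall>i < length w. \<forall>j < length w. w ! i \<le> w ! j \<longrightarrow> u ! i \<le> u ! j)"

definition weakly_finer :: "nat list \<Rightarrow> nat list \<Rightarrow> bool" where
  "weakly_finer w v \<longleftrightarrow> length w = length v \<and>
     (\<forall>i < length w. \<forall>j < length w. w ! i = w ! j \<longrightarrow> v ! i = v ! j)"

text \<open>The set \<open>W(u, v)\<close>.\<close>

definition common_refinements :: "nat list \<Rightarrow> nat list \<Rightarrow> nat list set" where
  "common_refinements u v =
     {w \<in> packed_words (length u). finer w u \<and> weakly_finer w v}"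

text \<open>\<open>restrict_word u i w\<close> is \<open>w\<^sup>(\<^sup>i\<^sup>)\<close>.\<close>

definition restrict_word :: "nat list \<Rightarrow> nat \<Rightarrow> nat list \<Rightarrow> nat list" where
  "restrict_word u i w = pack (nths w {j. j < length u \<and> u ! j = i})"


section \<open>Set compositions and \<open>a\<^sub>0\<close>\<close>

definition set_composition :: "nat list \<Rightarrow> nat set list" where
  "set_composition u = map (\<lambda>i. {j. j < length u \<and> u ! j = i}) [1..<Suc (wmax u)]"

definition merge_step :: "nat list \<Rightarrow> nat set list \<Rightarrow> nat set list \<Rightarrow> bool" where
  "merge_step v c d \<longleftrightarrow> (\<exists>xs p q ys. c = xs @ p # q # ys \<and> d = xs @ (p \<union> q) # ys \<and>
     (\<forall>i\<in>p. \<forall>j\<in>q. v ! i < v ! j))"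

text \<open>The order in which blocks are merged does not matter; see \<open>u0_unique\<close> below.\<close>

definition u0 :: "nat list \<Rightarrow> nat list \<Rightarrow> nat set list" where
  "u0 v w = (THE c. (merge_step v)\<^sup>*\<^sup>* (set_composition w) c \<and> (\<nexists>d. merge_step v c d))"

definition a0 :: "nat list \<Rightarrow> nat list \<Rightarrow> nat" where
  "a0 v w = length (u0 v w)"

lemma merge_step_diamond:
  assumes "merge_step v c d" "merge_step v c d'" "{} \<notin> set c"
  shows "d = d' \<or> (\<exists>e. merge_step v d e \<and> merge_step v d' e)"
proof -
  let ?lt = "\<lambda>p q. \<forall>i\<in>p. \<forall>j\<in>q. v ! i < v ! j"
  have main: "xs @ (p \<union> q) # ys = xs' @ (p' \<union> q') # ys' \<or>
      (\<exists>e. merge_step v (xs @ (p \<union> q) # ys) e \<and> merge_step v (xs' @ (p' \<union> q') # ys') e)"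
    if eq: "xs @ p # q # ys = xs' @ p' # q' # ys'" and pq: "?lt p q" and pq': "?lt p' q'"
      and ne: "{} \<notin> set (xs @ p # q # ys)" and len: "length xs \<le> length xs'"
    for xs p q ys xs' p' q' ys'
  proof -
    obtain zs where zs: "xs' = xs @ zs" "p # q # ys = zs @ p' # q' # ys'"
      using eq len by (auto simp: append_eq_append_conv2)
    consider "zs = []" | "zs = [p]" | ws where "zs = p # q # ws"
      using zs(2) by (cases zs; cases "tl zs") auto
    then show ?thesis
    proof cases
      case 1
      then show ?thesis using zs by simp
    next
      case 2
      have "q \<noteq> {}" "p' = q" "ys = q' # ys'" using ne zs 2 by auto
      then obtain k where "k \<in> q" by auto
      have lt: "?lt p q'" using pq pq' \<open>k \<in> q\<close> \<open>p' = q\<close> by (meson less_trans)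
      have "merge_step v (xs @ (p \<union> q) # ys) (xs @ (p \<union> q \<union> q') # ys')"
        unfolding merge_step_def
        by (rule exI[of _ xs], rule exI[of _ "p \<union> q"], rule exI[of _ q'], rule exI[of _ ys'])
          (use lt pq' \<open>p' = q\<close> \<open>ys = q' # ys'\<close> in auto)
      moreover have "merge_step v (xs' @ (p' \<union> q') # ys') (xs @ (p \<union> q \<union> q') # ys')"
        unfolding merge_step_def
        by (rule exI[of _ xs], rule exI[of _ p], rule exI[of _ "q \<union> q'"], rule exI[of _ ys'])
          (use lt pq \<open>p' = q\<close> zs(1) 2 in auto)
      ultimately show ?thesis by blast
    next
      case 3
      let ?e = "xs @ (p \<union> q) # ws @ (p' \<union> q') # ys'"
      have ys: "ys = ws @ p' # q' # ys'" using zs 3 by simp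
      have "merge_step v (xs @ (p \<union> q) # ys) ?e"
        unfolding merge_step_def
        by (rule exI[of _ "xs @ (p \<union> q) # ws"], rule exI[of _ p'], rule exI[of _ q'],
            rule exI[of _ ys']) (use pq' ys in auto)
      moreover have "merge_step v (xs' @ (p' \<union> q') # ys') ?e"
        unfolding merge_step_def
        by (rule exI[of _ xs], rule exI[of _ p], rule exI[of _ q],
            rule exI[of _ "ws @ (p' \<union> q') # ys'"]) (use pq zs(1) 3 in auto)
      ultimately show ?thesis by blast
    qed
  qed
  obtain xs p q ys where c: "c = xs @ p # q # ys" "d = xs @ (p \<union> q) # ys" "?lt p q"
    using assms(1) unfolding merge_step_def by blast
  obtain xs' p' q' ys' where c': "c = xs' @ p' # q' # ys'" "d' = xs' @ (p' \<union> q') # ys'" "?lt p' q'"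
    using assms(2) unfolding merge_step_def by blast
  show ?thesis
  proof (cases "length xs \<le> length xs'")
    case True
    show ?thesis
      unfolding c(2) c'(2)
      by (rule main[OF trans[OF c(1)[symmetric] c'(1)] c(3) c'(3) assms(3)[unfolded c(1)] True])
  next
    case False
    then have "length xs' \<le> length xs" by simp
    from main[OF trans[OF c'(1)[symmetric] c(1)] c'(3) c(3) assms(3)[unfolded c'(1)] this]
    show ?thesis
      unfolding c(2) c'(2) by (metis (no_types))
  qed
qed

lemma merge_step_nonempty: "merge_step v c d \<Longrightarrow> {} \<notin> set c \<Longrightarrow> {} \<notin> set d"
  unfolding merge_step_def by auto

lemma merge_steps_nonempty: "(merge_step v)\<^sup>*\<^sup>* c d \<Longrightarrow> {} \<notin> set c \<Longrightarrow> {} \<notin> set d"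
  by (induction rule: rtranclp_induct) (auto dest: merge_step_nonempty)

lemma merge_step_length: "merge_step v c d \<Longrightarrow> length d < length c"
  unfolding merge_step_def by auto

lemma set_composition_nonempty:
  assumes "packed w" shows "{} \<notin> set (set_composition w)"
proof -
  obtain r where r: "set w = {1..r}" using assms by (auto simp: packed_def)
  have "wmax w = r" unfolding wmax_def r by (rule Max_eqI) auto
  moreover have "\<exists>j < length w. w ! j = i" if "1 \<le> i" "i \<le> r" for i
    using r that by (metis atLeastAtMost_iff in_set_conv_nth)
  ultimately show ?thesis
    by (auto simp: set_composition_def) (metis One_nat_def less_imp_le)
qed

lemma u0_unique:
  assumes "packed w"
  shows "\<exists>!c. (merge_step v)\<^sup>*\<^sup>* (set_composition w) c \<and> (\<nexists>d. merge_step v c d)"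
proof -
  let ?r = "\<lambda>c d. {} \<notin> set c \<and> merge_step v c d"
  have r: "confluentp ?r"
  proof (rule strong_confluentp_imp_confluentp, rule strong_confluentpI)
    fix x y z assume *: "?r x y" "?r x z"
    then consider "y = z" | e where "merge_step v y e" "merge_step v z e"
      using merge_step_diamond by blast
    then show "\<exists>u. ?r\<^sup>*\<^sup>* y u \<and> ?r\<^sup>=\<^sup>= z u"
    proof cases
      case 1
      then show ?thesis by blast
    next
      case 2
      have "{} \<notin> set y" "{} \<notin> set z" using * merge_step_nonempty by blast+
      then have "?r\<^sup>*\<^sup>* y e" "?r\<^sup>=\<^sup>= z e" using 2 by (auto intro: r_into_rtranclp)
      then show ?thesis by blast
    qed
  qed
  have lift: "?r\<^sup>*\<^sup>* c d" if "(merge_step v)\<^sup>*\<^sup>* c d" "{} \<notin> set c" for c d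
    using that
  proof (induction rule: rtranclp_induct)
    case (step y z)
    then have "?r y z" using merge_steps_nonempty by blast
    with step show ?case by (auto intro: rtranclp.rtrancl_into_rtrancl)
  qed simp
  have ex: "\<exists>d. (merge_step v)\<^sup>*\<^sup>* c d \<and> (\<nexists>e. merge_step v d e)" for c
  proof (induction "length c" arbitrary: c rule: less_induct)
    case less
    show ?case
    proof (cases "\<exists>d. merge_step v c d")
      case True
      then obtain d where d: "merge_step v c d" by blast
      from less[OF merge_step_length[OF d]] d show ?thesis
        by (meson converse_rtranclp_into_rtranclp)
    next
      case False
      then show ?thesis by blast
    qed
  qed
  have "c = d"
    if cd: "(merge_step v)\<^sup>*\<^sup>* (set_composition w) c" "\<nexists>e. merge_step v c e"
       "(merge_step v)\<^sup>*\<^sup>* (set_composition w) d" "\<nexists>e. merge_step v d e" for c d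
  proof -
    note ne = set_composition_nonempty[OF assms]
    obtain e where e: "?r\<^sup>*\<^sup>* c e" "?r\<^sup>*\<^sup>* d e"
      using confluentpD[OF r lift[OF cd(1) ne] lift[OF cd(3) ne]] by blast
    have "c = e" using e(1) by (cases rule: converse_rtranclpE) (use cd(2) in blast)+
    moreover have "d = e" using e(2) by (cases rule: converse_rtranclpE) (use cd(4) in blast)+
    ultimately show ?thesis by simp
  qed
  with ex[of "set_composition w"] show ?thesis by (intro ex_ex1I) auto
qed


section \<open>The space \<open>WQSym\<^sup>*\<close> over \<open>K[t]\<close>\<close>

text \<open>Formal linear combinations of words with coefficients in \<open>K[t]\<close>; the homogeneous component of
  degree \<open>n\<close> consists of those supported on \<open>packed_words n\<close>. The elements \<open>NN u\<close> below are only
  meaningful for packed \<open>u\<close>.\<close>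

type_synonym 'a wqsym = "nat list \<Rightarrow>\<^sub>0 'a poly"

definition NN :: "nat list \<Rightarrow> 'a::field_char_0 wqsym" where
  "NN u = Poly_Mapping.single u 1"

definition scale :: "'a::field_char_0 poly \<Rightarrow> 'a wqsym \<Rightarrow> 'a wqsym" where
  "scale c F = Poly_Mapping.map (\<lambda>x. c * x) F"

text \<open>The internal product, extended \<open>K[t]\<close>-bilinearly. The order on biletters in
  \<open>pack (zip u v)\<close> is the lexicographic one. Words of different lengths have product zero.\<close>

definition internal_prod :: "'a::field_char_0 wqsym \<Rightarrow> 'a wqsym \<Rightarrow> 'a wqsym" (infixl "\<star>" 70) where
  "F \<star> G = (\<Sum>u\<in>Poly_Mapping.keys F. \<Sum>v\<in>Poly_Mapping.keys G.
     if length u = length v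
     then scale (Poly_Mapping.lookup F u * Poly_Mapping.lookup G v) (NN (pack (zip u v)))
     else 0)"

text \<open>\<open>tbinom c m\<close> is the polynomial \<open>(t + c)(t + c - 1)\<dots>(t + c - m + 1) / m!\<close>.\<close>

definition tbinom :: "int \<Rightarrow> nat \<Rightarrow> 'a::field_char_0 poly" where
  "tbinom c m = smult (1 / fact m) (\<Prod>j<m. [:of_int c - of_nat j, 1:])"

definition sigma_t :: "nat \<Rightarrow> 'a::field_char_0 wqsym" where
  "sigma_t n = (\<Sum>u\<in>packed_words n. scale (tbinom 0 (wmax u)) (NN u))"

lemma lookup_scale [simp]:
  "Poly_Mapping.lookup (scale c F) u = c * Poly_Mapping.lookup F u"
  by (simp add: scale_def Poly_Mapping.map.rep_eq when_def)

lemma scale_1 [simp]: "scale 1 F = F"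
  by (rule poly_mapping_eqI) simp

lemma internal_prod_NN:
  "length u = length v \<Longrightarrow> NN u \<star> NN v = (NN (pack (zip u v)) :: 'a::field_char_0 wqsym)"
  by (simp add: internal_prod_def NN_def)

lemma finite_packed_words: "finite (packed_words n)"
proof (rule finite_subset)
  show "packed_words n \<subseteq> {u. set u \<subseteq> {1..n} \<and> length u = n}"
  proof
    fix u assume "u \<in> packed_words n"
    then obtain r where r: "set u = {1..r}" "length u = n"
      by (auto simp: packed_words_def packed_def)
    have "r \<le> n" using card_length[of u] r by simp
    then show "u \<in> {u. set u \<subseteq> {1..n} \<and> length u = n}" using r by auto
  qed
qed (rule finite_lists_length_eq, simp)

end

theory Submission
  imports Defs
begin

text \<open>The coefficient of \<open>NN w\<close> is \<open>\<Sum> tbinom 0 (wmax x)\<close> over the packed \<open>x\<close> such that the word of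
  triples \<open>(u, x, v)\<close> packs to \<open>w\<close>. At \<open>t = N\<close> it counts all words \<open>y\<close> over \<open>{1..N}\<close>, packed or not,
  with this property, as \<open>N choose wmax x\<close> of them pack to \<open>x\<close>. Such a \<open>y\<close> is constant on the blocks of
  \<open>w\<close>, so it is a function of the letter of \<open>w\<close>, and so are \<open>u\<close> and \<open>v\<close>; the condition is that the triples
  increase strictly with that letter. Letters with different values of \<open>u\<close> do not interact, and on \<open>m\<close>
  letters with the same value of \<open>u\<close> the function \<open>y\<close> has to be weakly increasing, and strictly so where
  \<open>v\<close> does not ascend. If \<open>v\<close> splits into \<open>a\<close> maximal ascending runs, there are \<open>(N + m - a) choose m\<close>
  such functions, and \<open>a\<close> is the number of blocks left after merging.\<close>

section \<open>Packing\<close>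

text \<open>Only the relative order of letters enters a rank: \<open>\<phi>\<close> carries the
  letters up to \<open>b\<close> bijectively onto those up to \<open>\<phi> b\<close>.\<close>

lemma pack_map:
  assumes "strict_mono_on (set w) \<phi>"
  shows "pack (map \<phi> w) = pack w"
proof -
  have "card {c \<in> set (map \<phi> w). c \<le> \<phi> b} = card {c \<in> set w. c \<le> b}" if b: "b \<in> set w" for b
  proof -
    have "{c \<in> set (map \<phi> w). c \<le> \<phi> b} = \<phi> ` {c \<in> set w. c \<le> b}"
      using strict_mono_on_less_eq[OF assms _ b] by auto
    moreover have "inj_on \<phi> {c \<in> set w. c \<le> b}"
      using strict_mono_on_imp_inj_on[OF assms] by (rule inj_on_subset) auto
    ultimately show ?thesis by (simp add: card_image)
  qed
  then show ?thesis by (simp add: pack_def)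
qed

lemma strict_mono_on_rank:
  fixes S :: "'a::linorder set"
  assumes "finite S"
  shows "strict_mono_on S (\<lambda>b. card {c \<in> S. c \<le> b})"
proof (rule strict_mono_onI)
  fix a b assume "a \<in> S" "b \<in> S" "a < b"
  then have "{c \<in> S. c \<le> a} \<subset> {c \<in> S. c \<le> b}" by force
  then show "card {c \<in> S. c \<le> a} < card {c \<in> S. c \<le> b}"
    using assms by (simp add: psubset_card_mono)
qed

lemma length_pack [simp]: "length (pack w) = length w"
  by (simp add: pack_def)

text \<open>Ranks are distinct on distinct letters and lie between 1 and the number of letters, so
  by cardinality every value is taken.\<close>

lemma set_pack: "set (pack w) = {1..card (set w)}"
proof -
  let ?r = "\<lambda>b. card {c \<in> set w. c \<le> b}"
  have "inj_on ?r (set w)"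
    by (rule strict_mono_on_imp_inj_on[OF strict_mono_on_rank]) simp
  then have "card (?r ` set w) = card {1..card (set w)}" by (simp add: card_image)
  moreover have "?r ` set w \<subseteq> {1..card (set w)}"
    by (auto simp: Suc_le_eq card_gt_0_iff intro!: card_mono)
  ultimately have "?r ` set w = {1..card (set w)}" by (intro card_subset_eq) auto
  then show ?thesis by (simp add: pack_def)
qed

lemma packed_pack: "packed (pack w)"
  using set_pack packed_def by blast

lemma wmax_eqI: "set w = {1..r} \<Longrightarrow> wmax w = r"
  unfolding wmax_def by (intro Max_eqI) auto

lemma set_packed: "packed w \<Longrightarrow> set w = {1..wmax w}"
  using wmax_eqI by (auto simp: packed_def)

lemma wmax_pack: "wmax (pack w) = card (set w)"
  by (rule wmax_eqI[OF set_pack])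

lemma pack_packed:
  assumes "packed w" shows "pack w = w"
proof -
  have "{c \<in> set w. c \<le> b} = {1..b}" if "b \<in> set w" for b
    using that set_packed[OF assms] by auto
  then have "pack w = map (\<lambda>b. card {1..b}) w" unfolding pack_def by (intro map_cong) simp_all
  then show ?thesis by simp
qed

lemma pack_nth_le_iff:
  assumes "i < length w" "j < length w"
  shows "pack w ! i \<le> pack w ! j \<longleftrightarrow> w ! i \<le> w ! j"
  using strict_mono_on_less_eq[OF strict_mono_on_rank[of "set w"], of "w ! i" "w ! j"] assms
  by (simp add: pack_def)

text \<open>Replacing the top letter by its rank preserves the lexicographic order of biletters. A
  twofold product is therefore the packing of a single word of triples.\<close>

lemma pack_zip_pack_left: "pack (zip (pack z) v) = pack (zip z v)"
proof -
  let ?r = "\<lambda>b. card {c \<in> set z. c \<le> b}"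
  have "zip (pack z) v = map (\<lambda>p. (?r (fst p), snd p)) (zip z v)"
    unfolding pack_def by (simp add: zip_map1 split_def)
  moreover have "strict_mono_on (set (zip z v)) (\<lambda>p. (?r (fst p), snd p))"
  proof (rule strict_mono_onI)
    fix p q assume pq: "p \<in> set (zip z v)" "q \<in> set (zip z v)" "p < q"
    have "fst p \<in> set z" "fst q \<in> set z" using pq by (metis prod.collapse set_zip_leftD)+
    then show "(?r (fst p), snd p) < (?r (fst q), snd q)"
      using pq(3) strict_mono_on_less[OF strict_mono_on_rank[of "set z"], of "fst p" "fst q"]
       strict_mono_on_less_eq[OF strict_mono_on_rank[of "set z"], of "fst p" "fst q"]
      by (cases p; cases q) auto
  qed
  ultimately show ?thesis by (metis (no_types, lifting) pack_map)
qed

text \<open>The same argument for the middle letter. It allows \<open>y\<close> to range over all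
  words instead of packed ones when coefficients are counted.\<close>

lemma pack_zip_pack_middle: "pack (zip (zip u (pack y)) v) = pack (zip (zip u y) v)"
proof -
  let ?r = "\<lambda>b. card {c \<in> set y. c \<le> b}"
  let ?m = "\<lambda>p. ((fst (fst p), ?r (snd (fst p))), snd p)"
  have "zip (zip u (pack y)) v = map ?m (zip (zip u y) v)"
    unfolding pack_def by (simp add: zip_map1 zip_map2 split_def)
  moreover have "strict_mono_on (set (zip (zip u y) v)) ?m"
  proof (rule strict_mono_onI)
    fix p q assume pq: "p \<in> set (zip (zip u y) v)" "q \<in> set (zip (zip u y) v)" "p < q"
    have "snd (fst p) \<in> set y" "snd (fst q) \<in> set y"
      using pq by (metis prod.collapse set_zip_leftD set_zip_rightD)+
    then show "?m p < ?m q"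
      using pq(3) strict_mono_on_less[OF strict_mono_on_rank[of "set y"], of "snd (fst p)" "snd (fst q)"]
       strict_mono_on_less_eq[OF strict_mono_on_rank[of "set y"], of "snd (fst p)" "snd (fst q)"]
      by (cases p; cases q) auto
  qed
  ultimately show ?thesis by (metis (no_types, lifting) pack_map)
qed

text \<open>This turns a word that is constant on the blocks of \<open>w\<close> into a function of
  the letters of \<open>w\<close>.\<close>

lemma list_factors_through:
  assumes "length z = length w"
    and "\<And>i j. \<lbrakk>i < length w; j < length w; w ! i = w ! j\<rbrakk> \<Longrightarrow> z ! i = z ! j"
  obtains \<phi> where "z = map \<phi> w"
proof -
  \<comment> \<open>Any position carrying the letter \<open>a\<close> serves, since \<open>z\<close>
    agrees on all of them; values off the letters of \<open>w\<close> are irrelevant.\<close>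
  define \<phi> where "\<phi> a = z ! (SOME j. j < length w \<and> w ! j = a)" for a
  have "\<phi> (w ! i) = z ! i" if "i < length w" for i
    unfolding \<phi>_def using someI[of "\<lambda>j. j < length w \<and> w ! j = w ! i" i] that assms(2) by blast
  then have "z = map \<phi> w" using assms(1) by (intro nth_equalityI) auto
  then show ?thesis ..
qed

text \<open>Packing preserves and reflects comparisons between positions, so
  \<open>map \<phi> w\<close> has to order the positions exactly as \<open>w\<close> does.\<close>

lemma pack_map_eq_iff:
  assumes "packed w"
  shows "pack (map \<phi> w) = w \<longleftrightarrow> strict_mono_on (set w) \<phi>"
proof
  assume eq: "pack (map \<phi> w) = w"
  show "strict_mono_on (set w) \<phi>"
  proof (rule strict_mono_onI)
    fix a b assume "a \<in> set w" "b \<in> set w" "a < b"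
    then obtain i j where "i < length w" "j < length w" "w ! i = a" "w ! j = b"
      by (metis in_set_conv_nth)
    then show "\<phi> a < \<phi> b" using pack_nth_le_iff[of j "map \<phi> w" i] \<open>a < b\<close> eq by auto
  qed
qed (simp add: pack_map pack_packed assms)

text \<open>A word with packing \<open>x\<close> is determined by its set of letters, and every
  subset of \<open>{1..N}\<close> with \<open>wmax x\<close> elements occurs as such a set.\<close>

lemma card_pack_fibre:
  assumes "packed x"
  shows "card {y. set y \<subseteq> {1..N} \<and> pack y = x} = N choose wmax x"
proof -
  let ?Y = "{y. set y \<subseteq> {1..N::nat} \<and> pack y = x}"
  have "bij_betw set ?Y {S. S \<subseteq> {1..N} \<and> card S = wmax x}"
  proof (rule bij_betw_imageI)
    show "inj_on set ?Y"
    proof (rule inj_onI)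
      fix y y' assume yy: "y \<in> ?Y" "y' \<in> ?Y" "set y = set y'"
      then have eq: "map (\<lambda>b. card {c \<in> set y. c \<le> b}) y = map (\<lambda>b. card {c \<in> set y. c \<le> b}) y'"
        by (simp add: pack_def)
      show "y = y'"
        by (rule map_inj_on[OF eq]) (use yy strict_mono_on_imp_inj_on[OF strict_mono_on_rank] in auto)
    qed
    show "set ` ?Y = {S. S \<subseteq> {1..N} \<and> card S = wmax x}"
    proof (intro equalityI subsetI)
      fix S assume "S \<in> set ` ?Y"
      then show "S \<in> {S. S \<subseteq> {1..N} \<and> card S = wmax x}" by (auto simp: wmax_pack)
    next
      fix S assume S: "S \<in> {S. S \<subseteq> {1..N} \<and> card S = wmax x}"
      then have fin: "finite S" using finite_subset by blast
      let ?s = "sorted_list_of_set S"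
      \<comment> \<open>The letter \<open>i\<close> of \<open>x\<close> is sent to the
        \<open>i\<close>-th smallest element of \<open>S\<close>; letters start at 1, list positions
        at 0.\<close>
      let ?e = "\<lambda>i. ?s ! (i - 1)"
      have len: "length ?s = wmax x" using S by simp
      have "sorted_wrt (<) ?s" by simp
      then have "strict_mono_on (set x) ?e"
        by (intro strict_mono_onI, intro sorted_wrt_nth_less[of "(<)" ?s])
          (use len set_packed[OF assms] in auto)
      then have "pack (map ?e x) = x" by (simp add: pack_map pack_packed assms)
      moreover have "set (map ?e x) = S"
      proof -
        have "set (map ?e x) = (!) ?s ` (\<lambda>i. i - 1) ` {1..wmax x}"
          by (simp add: set_packed[OF assms] image_image)
        also have "(\<lambda>i. i - 1) ` {1..wmax x} = {..<wmax x}"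
          by (force simp: image_iff intro: bexI[of _ "Suc _"])
        also have "(!) ?s ` {..<wmax x} = set ?s"
          using len by (auto simp: set_conv_nth)
        finally show ?thesis using fin by simp
      qed
      ultimately show "S \<in> set ` ?Y" using S by (intro image_eqI[of _ _ "map ?e x"]) auto
    qed
  qed
  then have "card ?Y = card {S. S \<subseteq> {1..N} \<and> card S = wmax x}" by (rule bij_betw_same_card)
  then show ?thesis by (simp add: n_subsets)
qed

section \<open>The number of blocks of \<open>u\<^sub>0\<close>\<close>

text \<open>The number of maximal segments in which \<open>P\<close> holds between all neighbours: a
  new segment starts wherever \<open>P\<close> fails.\<close>

fun runs :: "('b \<Rightarrow> 'b \<Rightarrow> bool) \<Rightarrow> 'b list \<Rightarrow> nat" where
  "runs P [] = 0"
| "runs P [x] = 1"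
| "runs P (x # y # zs) = (if P x y then 0 else 1) + runs P (y # zs)"

lemma runs_map: "runs P (map f xs) = runs (\<lambda>x y. P (f x) (f y)) xs"
  by (induction P\<equiv>"\<lambda>x y. P (f x) (f y)" xs rule: runs.induct) auto

lemma runs_cong:
  assumes "\<And>x y. \<lbrakk>x \<in> set xs; y \<in> set xs\<rbrakk> \<Longrightarrow> P x y = Q x y"
  shows "runs P xs = runs Q xs"
  using assms by (induction P xs rule: runs.induct) auto

lemma runs_le_length: "runs P xs \<le> length xs"
  by (induction P xs rule: runs.induct) auto

lemma runs_pos: "xs \<noteq> [] \<Longrightarrow> 0 < runs P xs"
  by (induction P xs rule: runs.induct) auto

text \<open>There is no break between \<open>p\<close> and \<open>q\<close>, and \<open>s\<close>
  behaves like \<open>p\<close> towards the left and like \<open>q\<close> towards the right, so all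
  breaks survive.\<close>

lemma runs_merge:
  assumes "P p q" "\<And>x. x \<in> set xs \<Longrightarrow> P x s = P x p" "\<And>y. y \<in> set ys \<Longrightarrow> P s y = P q y"
  shows "runs P (xs @ s # ys) = runs P (xs @ p # q # ys)"
  using assms(2)
proof (induction xs)
  case Nil
  then show ?case using assms(1,3) by (cases ys) auto
next
  case (Cons x xs)
  then show ?case using assms(1) by (cases xs) auto
qed

lemma runs_eq_length:
  assumes "\<nexists>as p q bs. xs = as @ p # q # bs \<and> P p q"
  shows "runs P xs = length xs"
  using assms
proof (induction P xs rule: runs.induct)
  case (3 P x y zs)
  have "\<not> P x y" using 3(2) by (metis append_Nil)
  moreover have "\<nexists>as p q bs. y # zs = as @ p # q # bs \<and> P p q"
    using 3(2) by (metis append_Cons)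
  ultimately show ?case using 3(1) by simp
qed auto

text \<open>Merging does not change the number of runs of blocks, which in a fully merged composition is the
  number of blocks.\<close>

lemma runs_merge_step:
  assumes "merge_step v c d" "{} \<notin> set c"
  shows "runs (\<lambda>p q. \<forall>i\<in>p. \<forall>j\<in>q. v ! i < v ! j) d = runs (\<lambda>p q. \<forall>i\<in>p. \<forall>j\<in>q. v ! i < v ! j) c"
proof -
  obtain xs p q ys where c: "c = xs @ p # q # ys" "d = xs @ (p \<union> q) # ys"
    and pq: "\<forall>i\<in>p. \<forall>j\<in>q. v ! i < v ! j"
    using assms(1) unfolding merge_step_def by blast
  \<comment> \<open>Elements of \<open>p\<close> and \<open>q\<close> serve as intermediate points
    for transitivity: a block below \<open>p\<close> is then below \<open>q\<close>, and a block
    above \<open>q\<close> is above \<open>p\<close>.\<close>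
  obtain i j where ij: "i \<in> p" "j \<in> q" using assms(2) c by fastforce
  show ?thesis unfolding c
    by (rule runs_merge) (use pq ij in \<open>auto intro: less_trans\<close>)
qed

text \<open>The number of runs is constant along the merging. At the end it is the number of blocks;
  at the start the block of the letter \<open>a\<close> carries the constant value
  \<open>g a\<close>.\<close>

lemma a0_eq_runs:
  assumes "set w = {1..m}"
  shows "a0 (map g w) w = runs (\<lambda>a b. g a < g b) [1..<Suc m]"
proof -
  have w: "packed w" using assms packed_def by blast
  let ?v = "map g w"
  let ?P = "\<lambda>p q. \<forall>i\<in>p. \<forall>j\<in>q. ?v ! i < ?v ! j"
  have u0: "(merge_step ?v)\<^sup>*\<^sup>* (set_composition w) (u0 ?v w)" "\<nexists>d. merge_step ?v (u0 ?v w) d"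
    using theI'[OF u0_unique[OF w, of ?v]] by (simp_all add: u0_def)
  have "runs ?P (u0 ?v w) = runs ?P (set_composition w)"
    using u0(1)
  proof (induction rule: rtranclp_induct)
    case (step y z)
    have "{} \<notin> set y"
      by (rule merge_steps_nonempty[OF step.hyps(1) set_composition_nonempty[OF w]])
    then show ?case using runs_merge_step[OF step.hyps(2)] step.IH by simp
  qed simp
  moreover have "runs ?P (u0 ?v w) = length (u0 ?v w)"
    by (rule runs_eq_length) (use u0(2) in \<open>auto simp: merge_step_def\<close>)
  moreover have "runs ?P (set_composition w) = runs (\<lambda>a b. g a < g b) [1..<Suc m]"
    unfolding set_composition_def runs_map wmax_eqI[OF assms]
  proof (rule runs_cong)
    fix a b assume "a \<in> set [1..<Suc m]" "b \<in> set [1..<Suc m]"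
    then have "a \<in> set w" "b \<in> set w" using assms by auto
    \<comment> \<open>These positions show that both blocks are non-empty, so that the comparison of
      blocks is not vacuously true.\<close>
    then obtain i j where "i < length w" "j < length w" "w ! i = a" "w ! j = b"
      by (metis in_set_conv_nth)
    then show "?P {j. j < length w \<and> w ! j = a} {j. j < length w \<and> w ! j = b} = (g a < g b)"
      by auto
  qed
  ultimately show ?thesis by (simp add: a0_def)
qed

text \<open>Packing relabels the letters of \<open>w\<close> and the values of \<open>g\<close>
  increasingly, which leaves the ascents of \<open>g\<close> along the sorted letters
  unchanged.\<close>

lemma a0_pack:
  fixes g :: "'b::linorder \<Rightarrow> 'c::linorder"
  shows "a0 (pack (map g w)) (pack w) = runs (\<lambda>a b. g a < g b) (sorted_list_of_set (set w))"
proof -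
  let ?m = "card (set w)" and ?s = "sorted_list_of_set (set w)"
  define \<psi> where "\<psi> b = card {c \<in> set w. c \<le> b}" for b
  define \<phi> where "\<phi> b = card {c \<in> g ` set w. c \<le> b}" for b
  \<comment> \<open>Recovering a letter from its rank exhibits \<open>pack (map g w)\<close> as a
    function of the letters of \<open>pack w\<close>.\<close>
  define \<chi> where "\<chi> = inv_into (set w) \<psi>"
  have \<psi>: "strict_mono_on (set w) \<psi>" unfolding \<psi>_def by (rule strict_mono_on_rank) simp
  have \<phi>: "strict_mono_on (g ` set w) \<phi>" unfolding \<phi>_def by (rule strict_mono_on_rank) simp
  have inj: "inj_on \<psi> (set w)" using \<psi> by (rule strict_mono_on_imp_inj_on)
  have pw: "pack w = map \<psi> w" by (simp add: pack_def \<psi>_def)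
  have im: "\<psi> ` set w = {1..?m}" using set_pack[of w] by (simp add: pw)
  have s: "map \<psi> ?s = [1..<Suc ?m]"
  proof (rule sorted_distinct_set_unique)
    show "sorted (map \<psi> ?s)"
      unfolding sorted_map
      by (rule sorted_wrt_mono_rel[of _ "(\<le>)"]) (use strict_mono_on_less_eq[OF \<psi>] in auto)
    show "set (map \<psi> ?s) = set [1..<Suc ?m]" using im by auto
  qed (use inj in \<open>simp_all add: distinct_map del: upt_Suc\<close>)
  have "map g w = map (g \<circ> \<chi>) (map \<psi> w)"
    using inj by (auto simp: \<chi>_def)
  then have "pack (map g w) = map (\<phi> \<circ> g \<circ> \<chi>) (pack w)"
    unfolding pw by (simp add: pack_def \<phi>_def)
  then have "a0 (pack (map g w)) (pack w) = runs (\<lambda>a b. \<phi> (g (\<chi> a)) < \<phi> (g (\<chi> b))) (map \<psi> ?s)"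
    using a0_eq_runs[OF set_pack, of "\<phi> \<circ> g \<circ> \<chi>" w] s by simp
  also have "\<dots> = runs (\<lambda>a b. g a < g b) ?s"
    unfolding runs_map
    by (rule runs_cong) (use inj strict_mono_on_less[OF \<phi>] in \<open>auto simp: \<chi>_def\<close>)
  finally show ?thesis .
qed

section \<open>Counting the words with a prescribed packing\<close>

text \<open>The list \<open>xs\<close> stands for the letters of \<open>w\<close>, \<open>f\<close>
  and \<open>g\<close> for \<open>u\<close> and \<open>v\<close> as functions of these letters, and
  \<open>hs\<close> tabulates \<open>y\<close>. The nesting of pairs matches
  \<open>zip (zip u y) v\<close>.\<close>

definition increasing_fillings ::
    "('b \<Rightarrow> 'c::linorder) \<Rightarrow> ('b \<Rightarrow> 'd::linorder) \<Rightarrow> nat set \<Rightarrow> 'b list \<Rightarrow> nat list set" where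
  "increasing_fillings f g A xs = {hs. length hs = length xs \<and> set hs \<subseteq> A \<and>
     sorted_wrt (<) (map2 (\<lambda>a h. ((f a, h), g a)) xs hs)}"

lemma finite_increasing_fillings: "finite A \<Longrightarrow> finite (increasing_fillings f g A xs)"
  unfolding increasing_fillings_def
  by (rule finite_subset[OF _ finite_lists_length_eq[of A "length xs"]]) auto

lemma increasing_fillings_Nil: "increasing_fillings f g A [] = {[]}"
  by (auto simp: increasing_fillings_def)

text \<open>Comparisons between the two parts are decided by \<open>f\<close> alone, so the two
  parts are filled independently.\<close>

lemma card_increasing_fillings_append:
  assumes "\<And>a b. \<lbrakk>a \<in> set xs; b \<in> set ys\<rbrakk> \<Longrightarrow> f a < f b"
  shows "card (increasing_fillings f g A (xs @ ys)) =
    card (increasing_fillings f g A xs) * card (increasing_fillings f g A ys)"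
proof -
  have "bij_betw (\<lambda>(hs, ks). hs @ ks)
     (increasing_fillings f g A xs \<times> increasing_fillings f g A ys) (increasing_fillings f g A (xs @ ys))"
  proof (rule bij_betw_imageI)
    show "inj_on (\<lambda>(hs, ks). hs @ ks) (increasing_fillings f g A xs \<times> increasing_fillings f g A ys)"
      by (auto simp: inj_on_def increasing_fillings_def)
    show "(\<lambda>(hs, ks). hs @ ks) ` (increasing_fillings f g A xs \<times> increasing_fillings f g A ys) =
        increasing_fillings f g A (xs @ ys)" (is "?L = ?R")
    proof (intro equalityI subsetI)
      fix hs assume "hs \<in> ?L"
      then show "hs \<in> ?R"
        using assms by (auto simp: increasing_fillings_def sorted_wrt_append dest!: set_zip_leftD)
    next
      fix hs assume hs: "hs \<in> ?R"
      let ?a = "take (length xs) hs" and ?b = "drop (length xs) hs"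
      have len: "length ?a = length xs" "length ?b = length ys"
        using hs by (auto simp: increasing_fillings_def)
      have "set ?a \<subseteq> A" "set ?b \<subseteq> A"
        using hs set_take_subset[of "length xs" hs] set_drop_subset[of "length xs" hs]
        by (auto simp: increasing_fillings_def)
      moreover have "sorted_wrt (<) (map2 (\<lambda>a h. ((f a, h), g a)) (xs @ ys) (?a @ ?b))"
        using hs unfolding increasing_fillings_def by simp
      ultimately have "?a \<in> increasing_fillings f g A xs" "?b \<in> increasing_fillings f g A ys"
        using len by (simp_all add: increasing_fillings_def sorted_wrt_append del: append_take_drop_id)
      then show "hs \<in> ?L" by (intro image_eqI[of _ _ "(?a, ?b)"]) auto
    qed
  qed
  then show ?thesis by (simp add: bij_betw_same_card[symmetric] card_cartesian_product)
qed

lemma increasing_fillings_singleton: "increasing_fillings f g A [a] = (\<lambda>h. [h]) ` A"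
  by (auto simp: increasing_fillings_def length_Suc_conv)

lemma increasing_fillings_Cons_Cons:
  "h # k # hs \<in> increasing_fillings f g A (a # b # xs) \<longleftrightarrow>
    h \<in> A \<and> ((f a, h), g a) < ((f b, k), g b) \<and> k # hs \<in> increasing_fillings f g A (b # xs)"
proof -
  let ?l = "map2 (\<lambda>a h. ((f a, h), g a)) xs hs"
  have "sorted_wrt (<) (((f a, h), g a) # ((f b, k), g b) # ?l) \<longleftrightarrow>
     ((f a, h), g a) < ((f b, k), g b) \<and> sorted_wrt (<) (((f b, k), g b) # ?l)"
    by (rule sorted_wrt2) (rule transp_on_less)
  then show ?thesis unfolding increasing_fillings_def by auto
qed

lemma increasing_fillings_mono: "A \<subseteq> B \<Longrightarrow> increasing_fillings f g A xs \<subseteq> increasing_fillings f g B xs"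
  by (auto simp: increasing_fillings_def)

text \<open>Where \<open>f\<close> is constant, increasing triples force weakly increasing middle
  entries.\<close>

lemma increasing_fillings_ge_hd:
  assumes "h # hs \<in> increasing_fillings f g A (a # xs)" "\<And>b. b \<in> set xs \<Longrightarrow> f b = f a"
  shows "h # hs \<in> increasing_fillings f g {h..} (a # xs)"
proof -
  have "h \<le> k" if k: "k \<in> set hs" for k
  proof -
    have len: "length xs = length hs" using assms(1) by (simp add: increasing_fillings_def)
    obtain i where i: "i < length hs" "hs ! i = k" using k by (metis in_set_conv_nth)
    then have "(xs ! i, k) \<in> set (zip xs hs)" using len by (force simp: set_zip)
    then have "((f a, h), g a) < ((f (xs ! i), k), g (xs ! i))"
      using assms(1) by (auto simp: increasing_fillings_def)
    then show ?thesis using assms(2)[of "xs ! i"] i len by auto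
  qed
  then show ?thesis using assms(1) by (auto simp: increasing_fillings_def)
qed

text \<open>This is the recursion for adding a new least value \<open>l\<close>. If the first entry
  is not \<open>l\<close>, no entry is. If it is, the next entry may be \<open>l\<close> again
  exactly when \<open>g\<close> ascends from \<open>a\<close> to \<open>b\<close>.\<close>

lemma increasing_fillings_insert:
  assumes l: "\<And>h. h \<in> A \<Longrightarrow> l < h" and f: "\<And>c. c \<in> set (b # xs) \<Longrightarrow> f c = f a"
  shows "increasing_fillings f g (insert l A) (a # b # xs) =
    (#) l ` increasing_fillings f g (if g a < g b then insert l A else A) (b # xs) \<union>
      increasing_fillings f g A (a # b # xs)" (is "?L = (#) l ` ?B \<union> ?R")
proof (intro equalityI subsetI)
  fix hs assume hs: "hs \<in> ?L"
  then obtain h k ks where ks: "hs = h # k # ks"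
    by (auto simp: increasing_fillings_def length_Suc_conv)
  have k: "k # ks \<in> increasing_fillings f g (insert l A) (b # xs)"
    and h: "h \<in> insert l A" and less: "((f a, h), g a) < ((f b, k), g b)"
    using hs unfolding ks increasing_fillings_Cons_Cons by auto
  have k': "k # ks \<in> increasing_fillings f g {k..} (b # xs)"
    by (rule increasing_fillings_ge_hd[OF k]) (use f in auto)
  have above: "k # ks \<in> increasing_fillings f g A (b # xs)" if "l < k"
    using k k' that by (force simp: increasing_fillings_def)
  show "hs \<in> (#) l ` ?B \<union> ?R"
  proof (cases "h = l")
    case True
    then have "k # ks \<in> ?B" using less above k f[of b] by auto
    then show ?thesis using ks True by auto
  next
    case False
    then have "h \<in> A" "l < k" using h less l f[of b] by fastforce+
    then show ?thesis using above less unfolding ks by (auto simp: increasing_fillings_Cons_Cons)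
  qed
next
  fix hs assume "hs \<in> (#) l ` ?B \<union> ?R"
  then consider ks where "hs = l # ks" "ks \<in> ?B" | "hs \<in> ?R" by auto
  then show "hs \<in> ?L"
  proof cases
    case 1
    then obtain k ks' where ks: "ks = k # ks'" by (auto simp: increasing_fillings_def length_Suc_conv)
    have "ks \<in> increasing_fillings f g (insert l A) (b # xs)"
      using 1(2) increasing_fillings_mono[of A "insert l A"] by (auto split: if_splits)
    moreover have "k \<in> (if g a < g b then insert l A else A)"
      using 1(2) ks by (simp add: increasing_fillings_def)
    then have "((f a, l), g a) < ((f b, k), g b)" using l f[of b] by (auto split: if_splits)
    ultimately show ?thesis unfolding 1(1) ks by (simp add: increasing_fillings_Cons_Cons)
  next
    case 2
    then show ?thesis using increasing_fillings_mono[of A "insert l A"] by blast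
  qed
qed

text \<open>An outer induction adds a new least value to \<open>A\<close>, an inner one shortens
  \<open>xs\<close>; the recursion for \<open>insert l A\<close> becomes Pascal's rule.\<close>

lemma card_increasing_fillings_const:
  assumes "finite A" "\<And>a b. \<lbrakk>a \<in> set xs; b \<in> set xs\<rbrakk> \<Longrightarrow> f a = f b"
  shows "card (increasing_fillings f g A xs) =
    (card A + length xs - runs (\<lambda>a b. g a < g b) xs) choose length xs"
  using assms
proof (induction A arbitrary: xs rule: finite_linorder_min_induct)
  case empty
  show ?case
  proof (cases xs)
    case (Cons a ys)
    \<comment> \<open>With \<open>card A = 0\<close> a positive number of runs pushes the upper
      index below \<open>length xs\<close>, so the binomial coefficient vanishes.\<close>
    then have "runs (\<lambda>a b. g a < g b) xs > 0" by (simp add: runs_pos)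
    moreover have "increasing_fillings f g {} xs = {}" using Cons by (auto simp: increasing_fillings_def)
    ultimately show ?thesis using Cons by simp
  qed (simp add: increasing_fillings_Nil)
next
  case (insert l A)
  have l: "l \<notin> A" using insert.hyps by auto
  show ?case using insert.prems
  proof (induction xs)
    case Nil
    then show ?case by (simp add: increasing_fillings_Nil)
  next
    case (Cons a ys)
    show ?case
    proof (cases ys)
      case Nil
      then have "card (increasing_fillings f g (insert l A) (a # ys)) = card (insert l A)"
        unfolding Nil increasing_fillings_singleton by (intro card_image) (simp add: inj_on_def)
      then show ?thesis using Nil by simp
    next
      case (Cons b zs)
      let ?R = "runs (\<lambda>a b. g a < g b)"
      \<comment> \<open>The upper index for filling the tail \<open>ys\<close> from
        \<open>A\<close>; having \<open>l\<close> available as well raises it by one.\<close>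
      let ?n = "card A + length ys - ?R ys"
      let ?B = "increasing_fillings f g (if g a < g b then insert l A else A) ys"
      have f: "f c = f d" if "c \<in> set (a # ys)" "d \<in> set (a # ys)" for c d
        using Cons.prems that by blast
      \<comment> \<open>This keeps the subtractions of natural numbers from truncating.\<close>
      have R: "?R ys \<le> length ys" by (rule runs_le_length)
      have "card (increasing_fillings f g (insert l A) (a # ys)) =
         card ((#) l ` ?B) + card (increasing_fillings f g A (a # ys))"
        unfolding \<open>ys = b # zs\<close>
      proof (subst increasing_fillings_insert)
        show "f c = f a" if "c \<in> set (b # zs)" for c using f that \<open>ys = b # zs\<close> by simp
        show "card ((#) l ` increasing_fillings f g (if g a < g b then insert l A else A) (b # zs) \<union>
            increasing_fillings f g A (a # b # zs)) =
          card ((#) l ` increasing_fillings f g (if g a < g b then insert l A else A) (b # zs)) +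
          card (increasing_fillings f g A (a # b # zs))"
          by (rule card_Un_disjoint)
            (use insert.hyps l in \<open>auto simp: finite_increasing_fillings, auto simp: increasing_fillings_def\<close>)
      qed (use insert.hyps in auto)
      also have "card ((#) l ` ?B) = card ?B" by (simp add: card_image)
      also have "card ?B = (if g a < g b then ?n + 1 else ?n) choose length ys"
      proof -
        \<comment> \<open>Tails that may use \<open>l\<close> fall under the inner induction, tails
          over \<open>A\<close> under the outer one.\<close>
        have "card (increasing_fillings f g (insert l A) ys) = (?n + 1) choose length ys"
          by (subst Cons.IH) (use f R l insert.hyps(1) in \<open>auto simp: Suc_diff_le\<close>)
        moreover have "card (increasing_fillings f g A ys) = ?n choose length ys"
          by (rule insert.IH, rule f) simp_all
        ultimately show ?thesis by simp
      qed
      also have "card (increasing_fillings f g A (a # ys)) =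
          (card A + Suc (length ys) - ?R (a # ys)) choose Suc (length ys)"
        by (subst insert.IH[OF f]) simp_all
      also have "\<dots> = (if g a < g b then ?n + 1 else ?n) choose Suc (length ys)"
        using R by (simp add: \<open>ys = b # zs\<close> Suc_diff_le)
      \<comment> \<open>Both summands have the same upper index and consecutive lower indices, as
        Pascal's rule requires.\<close>
      finally show ?thesis
        using R l insert.hyps(1) by (simp add: \<open>ys = b # zs\<close> Suc_diff_le)
    qed
  qed
qed

text \<open>Sortedness cuts \<open>xs\<close> into consecutive segments of constant
  \<open>f\<close>, which are filled independently; the segment with the largest value is split off
  in each step. Absent values contribute the factor 1.\<close>

lemma card_increasing_fillings:
  assumes "finite A" "sorted (map f xs)" "\<And>a. a \<in> set xs \<Longrightarrow> f a \<in> {1..K::nat}"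
  shows "card (increasing_fillings f g A xs) =
    (\<Prod>i=1..K. (card A + length (filter (\<lambda>a. f a = i) xs)
        - runs (\<lambda>a b. g a < g b) (filter (\<lambda>a. f a = i) xs)) choose length (filter (\<lambda>a. f a = i) xs))"
  using assms(2,3)
proof (induction K arbitrary: xs)
  case 0
  then have "xs = []" by (cases xs) auto
  then show ?case by (simp add: increasing_fillings_Nil)
next
  case (Suc K)
  let ?l = "filter (\<lambda>a. f a \<le> K) xs" and ?h = "filter (\<lambda>a. f a = Suc K) xs"
  have "xs = ?l @ ?h"
    using Suc.prems
  proof (induction xs)
    case (Cons a xs)
    show ?case
    proof (cases "f a \<le> K")
      case False
      then have "\<forall>b \<in> set (a # xs). f b = Suc K" using Cons.prems by (fastforce simp: le_Suc_eq)
      then have "filter (\<lambda>a. f a = Suc K) (a # xs) = a # xs" "filter (\<lambda>a. f a \<le> K) (a # xs) = []"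
        by (simp_all add: filter_id_conv filter_empty_conv)
      then show ?thesis by simp
    qed (use Cons in simp)
  qed simp
  then have "card (increasing_fillings f g A xs) =
     card (increasing_fillings f g A ?l) * card (increasing_fillings f g A ?h)"
    using card_increasing_fillings_append[of ?l ?h f g A] by simp
  also have "card (increasing_fillings f g A ?l) = (\<Prod>i=1..K. (card A + length (filter (\<lambda>a. f a = i) ?l)
        - runs (\<lambda>a b. g a < g b) (filter (\<lambda>a. f a = i) ?l)) choose length (filter (\<lambda>a. f a = i) ?l))"
    by (rule Suc.IH) (use Suc.prems in \<open>auto intro: sorted_filter\<close>)
  also have "\<dots> = (\<Prod>i=1..K. (card A + length (filter (\<lambda>a. f a = i) xs)
        - runs (\<lambda>a b. g a < g b) (filter (\<lambda>a. f a = i) xs)) choose length (filter (\<lambda>a. f a = i) xs))"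
  proof (rule prod.cong[OF refl])
    fix i assume "i \<in> {1..K}"
    then have "filter (\<lambda>a. f a = i) ?l = filter (\<lambda>a. f a = i) xs" by (auto intro: filter_cong)
    then show "(card A + length (filter (\<lambda>a. f a = i) ?l)
        - runs (\<lambda>a b. g a < g b) (filter (\<lambda>a. f a = i) ?l)) choose length (filter (\<lambda>a. f a = i) ?l) =
      (card A + length (filter (\<lambda>a. f a = i) xs)
        - runs (\<lambda>a b. g a < g b) (filter (\<lambda>a. f a = i) xs)) choose length (filter (\<lambda>a. f a = i) xs)"
      by simp
  qed
  also have "card (increasing_fillings f g A ?h) = (card A + length ?h
        - runs (\<lambda>a b. g a < g b) ?h) choose length ?h"
    by (rule card_increasing_fillings_const[OF assms(1)]) simp
  finally show ?case by simp
qed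

text \<open>Such a \<open>y\<close> is constant on the blocks of \<open>w\<close>, hence has the
  form \<open>map h w\<close>, and the table of \<open>h\<close> on \<open>{1..r}\<close> is the
  corresponding filling.\<close>

lemma card_words_with_pack:
  assumes "set w = {1..r}"
  shows "card {y. length y = length w \<and> set y \<subseteq> A \<and> pack (zip (zip (map f w) y) (map g w)) = w} =
    card (increasing_fillings f g A [1..<Suc r])" (is "card ?Y = card ?H")
proof -
  have w: "packed w" using assms packed_def by blast
  \<comment> \<open>The word of triples is the image of \<open>w\<close> under \<open>?e\<close>, so
    it packs to \<open>w\<close> exactly when \<open>?e\<close> is strictly increasing on the
    letters.\<close>
  have key: "pack (zip (zip (map f w) (map h w)) (map g w)) = w \<longleftrightarrow>
      sorted_wrt (<) (map2 (\<lambda>a h. ((f a, h), g a)) [1..<Suc r] (map h [1..<Suc r]))" for h :: "nat \<Rightarrow> nat"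
  proof -
    let ?e = "\<lambda>a. ((f a, h a), g a)"
    have "zip (zip (map f w) (map h w)) (map g w) = map ?e w"
      by (induction w) auto
    then have "pack (zip (zip (map f w) (map h w)) (map g w)) = w \<longleftrightarrow> strict_mono_on {1..r} ?e"
      using pack_map_eq_iff[OF w, of ?e] assms by simp
    also have "\<dots> \<longleftrightarrow> sorted_wrt (\<lambda>a b. ?e a < ?e b) [1..<Suc r]"
    proof
      assume "strict_mono_on {1..r} ?e"
      then show "sorted_wrt (\<lambda>a b. ?e a < ?e b) [1..<Suc r]"
        by (intro sorted_wrt_mono_rel[OF _ sorted_wrt_upt]) (rule strict_mono_onD, auto simp del: upt_Suc)
    next
      assume s: "sorted_wrt (\<lambda>a b. ?e a < ?e b) [1..<Suc r]"
      show "strict_mono_on {1..r} ?e"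
      proof (rule strict_mono_onI)
        fix a b assume "a \<in> {1..r}" "b \<in> {1..r}" "a < b"
        then show "?e a < ?e b" using sorted_wrt_nth_less[OF s, of "a - 1" "b - 1"] by (simp del: upt_Suc)
      qed
    qed
    also have "map ?e [1..<Suc r] = map2 (\<lambda>a h. ((f a, h), g a)) [1..<Suc r] (map h [1..<Suc r])"
      by (simp add: zip_map2 split_def zip_same_conv_map del: upt_Suc)
    then have "sorted_wrt (\<lambda>a b. ?e a < ?e b) [1..<Suc r] \<longleftrightarrow>
        sorted_wrt (<) (map2 (\<lambda>a h. ((f a, h), g a)) [1..<Suc r] (map h [1..<Suc r]))"
      using sorted_wrt_map[of "(<)" ?e "[1..<Suc r]"] by (simp only:)
    finally show ?thesis .
  qed
  let ?\<Phi> = "\<lambda>hs. map (\<lambda>a. hs ! (a - 1)) w"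
  have hs: "map (\<lambda>a. hs ! (a - 1)) [1..<Suc r] = hs" if "length hs = r" for hs :: "nat list"
    by (rule nth_equalityI) (use that in \<open>auto simp del: upt_Suc\<close>)
  have "bij_betw ?\<Phi> ?H ?Y"
  proof (rule bij_betw_imageI)
    show "inj_on ?\<Phi> ?H"
    proof (rule inj_onI)
      fix hs ks assume "hs \<in> ?H" "ks \<in> ?H" and eq: "?\<Phi> hs = ?\<Phi> ks"
      then have len: "length hs = r" "length ks = r" by (auto simp: increasing_fillings_def)
      have "map (\<lambda>a. hs ! (a - 1)) [1..<Suc r] = map (\<lambda>a. ks ! (a - 1)) [1..<Suc r]"
        using eq assms by (simp del: upt_Suc)
      then show "hs = ks" unfolding hs[OF len(1)] hs[OF len(2)] .
    qed
    show "?\<Phi> ` ?H = ?Y"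
    proof (intro equalityI subsetI)
      fix y assume "y \<in> ?\<Phi> ` ?H"
      then obtain ks where ks: "ks \<in> ?H" "y = ?\<Phi> ks" by auto
      have len: "length ks = r" using ks by (auto simp: increasing_fillings_def)
      have "set y \<subseteq> set ks" using ks(2) len assms by auto
      then show "y \<in> ?Y"
        using key[of "\<lambda>a. ks ! (a - 1)"] ks unfolding hs[OF len] by (auto simp: increasing_fillings_def)
    next
      fix y assume y: "y \<in> ?Y"
      then have len: "length y = length w" by simp
      \<comment> \<open>Equal letters in the packing come from equal triples, whose middle entries
        are the letters of \<open>y\<close>.\<close>
      have "y ! i = y ! j" if "i < length w" "j < length w" "w ! i = w ! j" for i j
      proof -
        let ?z = "zip (zip (map f w) y) (map g w)"
        have "pack ?z ! i = pack ?z ! j" using y that by simp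
        then have "?z ! i = ?z ! j"
          using pack_nth_le_iff[of i ?z j] pack_nth_le_iff[of j ?z i] that len by (auto intro: antisym)
        then show ?thesis using that len by simp
      qed
      then obtain h where h: "y = map h w" using list_factors_through[OF len] by metis
      let ?ks = "map h [1..<Suc r]"
      have "?ks \<in> ?H"
        using y key[of h] assms unfolding h increasing_fillings_def by (auto simp del: upt_Suc)
      moreover have "?\<Phi> ?ks = y" using assms by (auto simp: h simp del: upt_Suc)
      ultimately show "y \<in> ?\<Phi> ` ?H" using image_eqI[of y ?\<Phi> ?ks ?H] by simp
    qed
  qed
  then show ?thesis by (rule bij_betw_same_card[symmetric])
qed

section \<open>Coefficients\<close>

text \<open>At \<open>t = N\<close> the numerator is the falling factorial of \<open>N + c\<close>;
  once this number is a natural \<open>M\<close>, an ordinary binomial coefficient results.\<close>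

lemma poly_tbinom:
  assumes "int N + c = int M"
  shows "poly (tbinom c m) (of_nat N) = (of_nat (M choose m) :: 'a::field_char_0)"
proof -
  have c: "c = int M - int N" using assms by simp
  have "poly (tbinom c m) (of_nat N) = (\<Prod>j<m. of_nat M - of_nat j :: 'a) / fact m"
    unfolding tbinom_def poly_smult poly_prod c by simp
  then show ?thesis
    by (simp add: binomial_gbinomial gbinomial_prod_rev lessThan_atLeast0)
qed

text \<open>In characteristic 0 the natural numbers give infinitely many points, too many roots for
  a nonzero difference.\<close>

lemma poly_eqI_of_nat:
  fixes p q :: "'a::field_char_0 poly"
  assumes "\<And>N. poly p (of_nat N) = poly q (of_nat N)"
  shows "p = q"
proof (rule ccontr)
  assume "p \<noteq> q"
  then have "finite {x. poly (p - q) x = 0}" by (intro poly_roots_finite) simp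
  moreover have "range of_nat \<subseteq> {x. poly (p - q) x = 0}" using assms by auto
  ultimately have "finite (range (of_nat :: nat \<Rightarrow> 'a))" by (rule rev_finite_subset)
  then show False by (simp add: finite_image_iff inj_on_def)
qed

text \<open>The words over \<open>{1..N}\<close> are grouped by their packing; \<open>Q\<close> is
  constant on each group, whose size is the binomial coefficient.\<close>

lemma sum_choose_wmax:
  assumes Q: "\<And>y. Q (pack y) \<longleftrightarrow> Q y"
  shows "(\<Sum>x\<in>{x \<in> packed_words n. Q x}. N choose wmax x) =
    card {y. length y = n \<and> set y \<subseteq> {1..N} \<and> Q y}"
proof -
  let ?X = "{x \<in> packed_words n. Q x}"
  have fin: "finite ?X" using finite_packed_words by simp
  have "{y. length y = n \<and> set y \<subseteq> {1..N} \<and> Q y} = (\<Union>x\<in>?X. {y. set y \<subseteq> {1..N} \<and> pack y = x})"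
    using Q by (auto simp: packed_words_def packed_pack)
  also have "card \<dots> = (\<Sum>x\<in>?X. card {y. set y \<subseteq> {1..N} \<and> pack y = x})"
  proof (rule card_UN_disjoint[OF fin], intro ballI)
    fix x assume "x \<in> ?X"
    then have "{y. set y \<subseteq> {1..N} \<and> pack y = x} \<subseteq> {y. set y \<subseteq> {1..N} \<and> length y = n}"
      by (auto simp: packed_words_def)
    then show "finite {y. set y \<subseteq> {1..N} \<and> pack y = x}"
      using finite_lists_length_eq[of "{1..N}" n] finite_subset by blast
  qed auto
  also have "\<dots> = (\<Sum>x\<in>?X. N choose wmax x)"
    by (intro sum.cong refl card_pack_fibre) (auto simp: packed_words_def)
  finally show ?thesis by simp
qed

text \<open>Both sides are evaluated at every natural \<open>N\<close>, where the left one counts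
  words, hence fillings, and the right one is the product formula for fillings.\<close>

lemma sum_tbinom_wmax:
  assumes u: "packed u" and n: "length u = n" "length v = n" and w: "w \<in> common_refinements u v"
  shows "(\<Sum>x\<in>{x \<in> packed_words n. pack (zip (pack (zip u x)) v) = w}. tbinom 0 (wmax x)) =
    (\<Prod>i=1..wmax u.
       tbinom (int (wmax (restrict_word u i w)) - int (a0 (restrict_word u i v) (restrict_word u i w)))
         (wmax (restrict_word u i w)) :: 'a::field_char_0 poly)"
proof (rule poly_eqI_of_nat)
  fix N
  let ?r = "wmax w"
  have lw: "length w = n" and pw: "packed w" and fin: "finer w u" and wf: "weakly_finer w v"
    using w n by (auto simp: common_refinements_def packed_words_def)
  have sw: "set w = {1..?r}" by (rule set_packed[OF pw])
  \<comment> \<open>Equal letters of \<open>w\<close> give inequalities both ways between the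
    letters of \<open>u\<close>, hence equality by antisymmetry.\<close>
  obtain f where f: "u = map f w"
    using list_factors_through[of u w] fin unfolding finer_def by (metis order_antisym order_refl)
  obtain g where g: "v = map g w"
    using list_factors_through[of v w] wf unfolding weakly_finer_def by metis
  have f_mono: "f a \<le> f b" if "a \<in> set w" "b \<in> set w" "a \<le> b" for a b
  proof -
    obtain i j where "i < length w" "j < length w" "w ! i = a" "w ! j = b"
      using \<open>a \<in> set w\<close> \<open>b \<in> set w\<close> by (metis in_set_conv_nth)
    then show ?thesis using fin \<open>a \<le> b\<close> by (auto simp: finer_def f)
  qed
  \<comment> \<open>These are the letters of \<open>w\<close> lying over the letter \<open>i\<close>
    of \<open>u\<close>, in increasing order.\<close>
  let ?x = "\<lambda>i. filter (\<lambda>a. f a = i) [1..<Suc ?r]"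
  have len: "wmax (restrict_word u i w) = length (?x i)"
    and a0: "a0 (restrict_word u i v) (restrict_word u i w) = runs (\<lambda>a b. g a < g b) (?x i)" for i
  proof -
    let ?w = "filter (\<lambda>a. f a = i) w"
    have "nths w {j. j < length u \<and> u ! j = i} = ?w"
      unfolding f filter_eq_nths by (rule arg_cong[of _ _ "nths w"]) auto
    then have r: "restrict_word u i w = pack ?w" "restrict_word u i v = pack (map g ?w)"
      by (simp_all add: restrict_word_def g nths_map)
    have s: "sorted_list_of_set (set ?w) = ?x i"
    proof (rule sorted_distinct_set_unique)
      show "set (sorted_list_of_set (set ?w)) = set (?x i)" using sw by auto
    qed (simp_all add: sorted_wrt_filter del: upt_Suc)
    show "wmax (restrict_word u i w) = length (?x i)"
      by (simp only: r wmax_pack s[symmetric] length_sorted_list_of_set)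
    show "a0 (restrict_word u i v) (restrict_word u i w) = runs (\<lambda>a b. g a < g b) (?x i)"
      unfolding r a0_pack s ..
  qed
  have "poly (\<Sum>x\<in>{x \<in> packed_words n. pack (zip (pack (zip u x)) v) = w}. tbinom 0 (wmax x)) (of_nat N :: 'a)
     = of_nat (\<Sum>x\<in>{x \<in> packed_words n. pack (zip (pack (zip u x)) v) = w}. N choose wmax x)"
    by (simp add: poly_sum poly_tbinom)
  also have "(\<Sum>x\<in>{x \<in> packed_words n. pack (zip (pack (zip u x)) v) = w}. N choose wmax x) =
      card {y. length y = n \<and> set y \<subseteq> {1..N} \<and> pack (zip (pack (zip u y)) v) = w}"
    by (rule sum_choose_wmax) (simp add: pack_zip_pack_left pack_zip_pack_middle)
  also have "\<dots> = card (increasing_fillings f g {1..N} [1..<Suc ?r])"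
    using card_words_with_pack[OF sw, of "{1..N}" f g] by (simp add: pack_zip_pack_left f g lw)
  also have "\<dots> = (\<Prod>i=1..wmax u. (N + length (?x i) - runs (\<lambda>a b. g a < g b) (?x i)) choose length (?x i))"
  proof (subst card_increasing_fillings)
    show "sorted (map f [1..<Suc ?r])"
      unfolding sorted_map
      by (rule sorted_wrt_mono_rel[of _ "(\<le>)"]) (use f_mono sw in \<open>auto simp del: upt_Suc\<close>)
    show "f a \<in> {1..wmax u}" if "a \<in> set [1..<Suc ?r]" for a
    proof -
      have "a \<in> set w" using that sw by auto
      then show ?thesis using set_packed[OF u] f by (metis image_eqI list.set_map)
    qed
  qed (simp_all del: upt_Suc)
  also have "of_nat \<dots> = poly (\<Prod>i=1..wmax u.
       tbinom (int (wmax (restrict_word u i w)) - int (a0 (restrict_word u i v) (restrict_word u i w)))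
         (wmax (restrict_word u i w))) (of_nat N :: 'a)"
    unfolding poly_prod of_nat_prod len a0
  proof (intro prod.cong refl poly_tbinom[symmetric])
    fix i
    show "int N + (int (length (?x i)) - int (runs (\<lambda>a b. g a < g b) (?x i))) =
       int (N + length (?x i) - runs (\<lambda>a b. g a < g b) (?x i))"
      \<comment> \<open>The number of runs never exceeds the length, so the integer and the natural
        differences agree.\<close>
      using runs_le_length[of "\<lambda>a b. g a < g b" "?x i"] by linarith
  qed
  finally show "poly (\<Sum>x\<in>{x \<in> packed_words n. pack (zip (pack (zip u x)) v) = w}. tbinom 0 (wmax x)) (of_nat N :: 'a) =
    poly (\<Prod>i=1..wmax u.
       tbinom (int (wmax (restrict_word u i w)) - int (a0 (restrict_word u i v) (restrict_word u i w)))
         (wmax (restrict_word u i w))) (of_nat N)" .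
qed

text \<open>The priority of the top letter makes the packing finer than \<open>u\<close>; equality
  of triples includes equality of their last letters, which gives weak refinement of
  \<open>v\<close>.\<close>

lemma pack_in_common_refinements:
  assumes "length u = n" "length x = n" "length v = n"
  shows "pack (zip (pack (zip u x)) v) \<in> common_refinements u v"
proof -
  let ?z = "zip (zip u x) v"
  have z: "?z ! i = ((u ! i, x ! i), v ! i)" if "i < n" for i
    using that assms by simp
  have le: "pack ?z ! i \<le> pack ?z ! j \<longleftrightarrow> ?z ! i \<le> ?z ! j" if "i < n" "j < n" for i j
    using that assms by (intro pack_nth_le_iff) simp_all
  have "finer (pack ?z) u"
    using assms le z by (auto simp: finer_def)
  moreover have "weakly_finer (pack ?z) v"
    unfolding weakly_finer_def
  proof (intro conjI allI impI)
    fix i j assume "i < length (pack ?z)" "j < length (pack ?z)" "pack ?z ! i = pack ?z ! j"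
    then have "i < n" "j < n" "?z ! i = ?z ! j" using le[of i j] le[of j i] assms by auto
    then show "v ! i = v ! j" using z by simp
  qed (use assms in simp)
  ultimately show ?thesis
    using assms by (simp add: common_refinements_def packed_words_def packed_pack pack_zip_pack_left)
qed

section \<open>Bilinearity of the internal product\<close>

text \<open>Extra indices contribute zero coefficients. Sums over a common index set make additivity
  a termwise matter although supports may shrink under addition.\<close>

lemma internal_prod_superset:
  fixes F G :: "'a::field_char_0 wqsym"
  assumes "finite A" "Poly_Mapping.keys F \<subseteq> A" "finite B" "Poly_Mapping.keys G \<subseteq> B"
  shows "F \<star> G = (\<Sum>u\<in>A. \<Sum>v\<in>B. if length u = length v
     then scale (Poly_Mapping.lookup F u * Poly_Mapping.lookup G v) (NN (pack (zip u v))) else 0)"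
proof -
  have 0: "scale 0 H = (0 :: 'a wqsym)" for H by (rule poly_mapping_eqI) simp
  let ?t = "\<lambda>u v. if length u = length v
     then scale (Poly_Mapping.lookup F u * Poly_Mapping.lookup G v) (NN (pack (zip u v))) else 0"
  have "F \<star> G = (\<Sum>u\<in>Poly_Mapping.keys F. \<Sum>v\<in>B. ?t u v)"
    unfolding internal_prod_def
    by (intro sum.cong refl sum.mono_neutral_left assms) (auto simp: in_keys_iff 0)
  also have "\<dots> = (\<Sum>u\<in>A. \<Sum>v\<in>B. ?t u v)"
    by (intro sum.mono_neutral_left assms) (auto simp: in_keys_iff 0 intro!: sum.neutral)
  finally show ?thesis .
qed

lemma scale_add_left: "scale (c + d) F = scale c F + scale d F"
  by (rule poly_mapping_eqI) (simp add: lookup_add algebra_simps)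

lemma scale_scale: "scale c (scale d F) = scale (c * d) F"
  by (rule poly_mapping_eqI) (simp add: mult.assoc)

lemma scale_add_right: "scale c (F + G) = scale c F + scale c G"
  by (rule poly_mapping_eqI) (simp add: lookup_add algebra_simps)

lemma scale_0_right: "scale c 0 = 0"
  by (rule poly_mapping_eqI) simp

lemma scale_sum_right: "scale c (\<Sum>x\<in>A. F x) = (\<Sum>x\<in>A. scale c (F x))"
  by (induction A rule: infinite_finite_induct) (simp_all add: scale_0_right scale_add_right)

lemma internal_prod_add_left:
  fixes F G H :: "'a::field_char_0 wqsym"
  shows "(F + G) \<star> H = F \<star> H + G \<star> H"
proof -
  let ?A = "Poly_Mapping.keys F \<union> Poly_Mapping.keys G" and ?B = "Poly_Mapping.keys H"
  have "Poly_Mapping.keys (F + G) \<subseteq> ?A" by (rule keys_add)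
  then have "(F + G) \<star> H = (\<Sum>u\<in>?A. \<Sum>v\<in>?B. if length u = length v
     then scale (Poly_Mapping.lookup (F + G) u * Poly_Mapping.lookup H v) (NN (pack (zip u v))) else 0)"
    by (intro internal_prod_superset) auto
  also have "\<dots> = (\<Sum>u\<in>?A. \<Sum>v\<in>?B. (if length u = length v
     then scale (Poly_Mapping.lookup F u * Poly_Mapping.lookup H v) (NN (pack (zip u v))) else 0)
     + (if length u = length v
     then scale (Poly_Mapping.lookup G u * Poly_Mapping.lookup H v) (NN (pack (zip u v))) else 0))"
    by (intro sum.cong refl) (simp add: lookup_add distrib_right scale_add_left)
  also have "\<dots> = F \<star> H + G \<star> H"
    by (subst (1 2) internal_prod_superset[of ?A _ ?B]) (auto simp: sum.distrib)
  finally show ?thesis .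
qed

lemma internal_prod_add_right:
  fixes F G H :: "'a::field_char_0 wqsym"
  shows "F \<star> (G + H) = F \<star> G + F \<star> H"
proof -
  let ?A = "Poly_Mapping.keys F" and ?B = "Poly_Mapping.keys G \<union> Poly_Mapping.keys H"
  have "Poly_Mapping.keys (G + H) \<subseteq> ?B" by (rule keys_add)
  then have "F \<star> (G + H) = (\<Sum>u\<in>?A. \<Sum>v\<in>?B. if length u = length v
     then scale (Poly_Mapping.lookup F u * Poly_Mapping.lookup (G + H) v) (NN (pack (zip u v))) else 0)"
    by (intro internal_prod_superset) auto
  also have "\<dots> = (\<Sum>u\<in>?A. \<Sum>v\<in>?B. (if length u = length v
     then scale (Poly_Mapping.lookup F u * Poly_Mapping.lookup G v) (NN (pack (zip u v))) else 0)
     + (if length u = length v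
     then scale (Poly_Mapping.lookup F u * Poly_Mapping.lookup H v) (NN (pack (zip u v))) else 0))"
    by (intro sum.cong refl) (simp add: lookup_add distrib_left scale_add_left)
  also have "\<dots> = F \<star> G + F \<star> H"
    by (subst (1 2) internal_prod_superset[of ?A _ ?B]) (auto simp: sum.distrib)
  finally show ?thesis .
qed

lemma internal_prod_0_left: "0 \<star> H = 0" and internal_prod_0_right: "H \<star> 0 = 0"
  by (simp_all add: internal_prod_def)

lemma internal_prod_sum_left: "(\<Sum>x\<in>A. F x) \<star> H = (\<Sum>x\<in>A. F x \<star> H)"
  by (induction A rule: infinite_finite_induct) (simp_all add: internal_prod_0_left internal_prod_add_left)

lemma internal_prod_sum_right: "H \<star> (\<Sum>x\<in>A. F x) = (\<Sum>x\<in>A. H \<star> F x)"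
  by (induction A rule: infinite_finite_induct) (simp_all add: internal_prod_0_right internal_prod_add_right)

lemma keys_scale: "Poly_Mapping.keys (scale c F) \<subseteq> Poly_Mapping.keys F"
  by (auto simp: in_keys_iff)

lemma internal_prod_scale_left:
  fixes F G :: "'a::field_char_0 wqsym"
  shows "scale c F \<star> G = scale c (F \<star> G)"
  by (subst internal_prod_superset[OF finite_keys keys_scale finite_keys order_refl])
    (auto simp: internal_prod_def scale_sum_right scale_scale scale_0_right mult.assoc intro!: sum.cong)

lemma internal_prod_scale_right:
  fixes F G :: "'a::field_char_0 wqsym"
  shows "F \<star> scale c G = scale c (F \<star> G)"
  by (subst internal_prod_superset[OF finite_keys order_refl finite_keys keys_scale])
    (auto simp: internal_prod_def scale_sum_right scale_scale scale_0_right mult_ac intro!: sum.cong)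

section \<open>Collecting the terms of the triple product\<close>

theorem mainTheorem5:
  fixes n :: nat and u v :: "nat list"
  assumes "packed u" and "length u = n"
    and "packed v" and "length v = n"
  shows "(NN u \<star> sigma_t n \<star> NN v :: 'a::field_char_0 wqsym) =
    (\<Sum>w\<in>common_refinements u v.
       scale (\<Prod>i=1..wmax u.
                tbinom (int (wmax (restrict_word u i w)) -
                        int (a0 (restrict_word u i v) (restrict_word u i w)))
                       (wmax (restrict_word u i w)))
             (NN w))"
proof -
  let ?W = "common_refinements u v" and ?X = "packed_words n"
  let ?p = "\<lambda>x. pack (zip (pack (zip u x)) v)"
  have fin: "finite ?W"
    by (rule finite_subset[OF _ finite_packed_words[of n]]) (auto simp: common_refinements_def assms(2))
  have prod: "NN u \<star> NN x \<star> NN v = (NN (?p x) :: 'a wqsym)" if "x \<in> ?X" for x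
    using that assms by (simp add: packed_words_def internal_prod_NN)
  have scale_sum_left: "scale (\<Sum>x\<in>A. c x) F = (\<Sum>x\<in>A. scale (c x) F)"
    for c :: "nat list \<Rightarrow> 'a poly" and A F
    by (rule poly_mapping_eqI) (simp add: lookup_sum sum_distrib_right)
  have "(NN u \<star> sigma_t n \<star> NN v :: 'a wqsym) = (\<Sum>x\<in>?X. scale (tbinom 0 (wmax x)) (NN (?p x)))"
    by (simp add: sigma_t_def internal_prod_sum_left internal_prod_sum_right
        internal_prod_scale_left internal_prod_scale_right prod)
  \<comment> \<open>The terms are grouped by the resulting word, which always lies in
    \<open>?W\<close>; a \<open>w\<close> that is not reached would only add an empty sum.\<close>
  also have "\<dots> = (\<Sum>w\<in>?W. \<Sum>x\<in>{x \<in> ?X. ?p x = w}. scale (tbinom 0 (wmax x)) (NN (?p x)))"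
    by (rule sum.group[symmetric, OF finite_packed_words fin])
      (use pack_in_common_refinements assms in \<open>auto simp: packed_words_def\<close>)
  also have "\<dots> = (\<Sum>w\<in>?W. scale (\<Sum>x\<in>{x \<in> ?X. ?p x = w}. tbinom 0 (wmax x)) (NN w))"
    unfolding scale_sum_left by (intro sum.cong) auto
  finally show ?thesis
    using sum_tbinom_wmax[OF assms(1,2,4), where 'a = 'a] by simp
qed

end
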